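(* Let $f:\mathbb R^N\to\mathbb R$ be a $\mathcal C^2$ function whose gradient is Lipschitz continuous on the bounded sets, and such that $\inf_{\mathbb R^N}f>-\infty$. For $\lambda>0$ let $E_\lambda:\mathbb R^N\times\mathbb R^N\to\mathbb R$ be defined by $$E_\lambda(x,u):=\tfrac12\|u\|^2+f(x)+\lambda\langle\nabla f(x),u\rangle .$$ Suppose that, for all sufficiently small $\lambda>0$, the function $E_\lambda$ satisfies the (KL) property. Let $\phi:\mathbb R^N\to\mathbb R_+$ be a damping potential which is differentiable, with $\nabla\phi$ locally Lipschitz continuous, and which satisfies the following growth conditions: (a) (local) there exist positive constants $\gamma,\delta,\epsilon$ such that, for all $u\in\mathbb R^N$ with $\|u\|\le\epsilon$, $\phi(u)\ge\gamma\|u\|^2$ and $\|\nabla\phi(u)\|\le\delta\|u\|$; (b) (global) there exist $p\ge1$ and $c>0$ such that $\phi(u)\ge c\|u\|^p$ for all $u\in\mathbb R^N$. Let $x:[0,+\infty[\to\mathbb R^N$ be a bounded solution trajectory of $$\ddot x(t)+\nabla\phi(\dot x(t))+\nabla f(x(t))=0 .$$ Then the following properties are satisfied: (i) $x(t)\to x_\infty$ as $t\to+\infty$, where $\nabla f(x_\infty)=0$; (ii) $\dot x\in L^1(0,+\infty;\mathbb R^N)$ and $\dot x(t)\to0$ as $t\to+\infty$; (iii) for all $\lambda>0$ sufficiently small there exists $\alpha>0$ for which the angle condition $$\langle\nabla E_\lambda(x,u),F(x,u)\rangle\ge\alpha\|\nabla E_\lambda(x,u)\|\,\|F(x,u)\|$$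 holds for all $(x,u)\in\Gamma$, and, for all $t$ sufficiently large, $$\|x(t)-x_\infty\|\le\frac1\alpha\,\theta\big(E_\lambda(x(t),\dot x(t))-E_\lambda(x_\infty,0)\big),$$ where $\theta$ is the desingularizing function for $E_\lambda$ at $(x_\infty,0)$.
   Context: $\mathbb R^N$ carries its Euclidean structure. A function $\phi:\mathbb R^N\to\mathbb R_+$ is a damping potential if it is nonnegative, convex and continuous, with $\phi(0)=0=\min\phi$ (and the minimal-norm element of $\partial\phi(u)$ is bounded on bounded sets, which is automatic in finite dimension). (KL) property: a differentiable function $G:\mathbb R^m\to\mathbb R$ satisfies the (KL) property if for each critical point $\bar z$ of $G$ there exist $\eta>0$, a neighborhood $U$ of $\bar z$ and a continuous concave increasing function $\theta:[0,\eta)\to[0,+\infty)$ with $\theta(0)=0$, $\theta\in\mathcal C^1(0,\eta)$ and $\theta'>0$ on $(0,\eta)$, such that $\theta'(G(z)-G(\bar z))\,\|\nabla G(z)\|\ge1$ for all $z\in U$ with $G(\bar z)<G(z)<G(\bar z)+\eta$. Such a $\theta$ is called a desingularizing function for $G$ at $\bar z$. Here $F(x,u)=(-u,\ \nabla\phi(u)+\nabla f(x))$ on $\mathbb R^N\times\mathbb R^N$, and $\Gamma=\bar B(0,R)\times\bar B(0,\epsilon)$ where $R\ge\sup_{t\ge0}\|x(t)\|$ and $\epsilon$ is the constant of condition (a). *)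

theory Defs
  imports "HOL-Analysis.Analysis"
begin

definition grad :: "('a::real_inner \<Rightarrow> real) \<Rightarrow> 'a \<Rightarrow> 'a"
  where "grad f x = (THE D. GDERIV f x :> D)"

text \<open>The Hessian \<open>H x\<close> is the derivative of the gradient; its continuity is with respect to the
  operator norm.\<close>

definition C2_function :: "('a::euclidean_space \<Rightarrow> real) \<Rightarrow> bool"
  where "C2_function f \<longleftrightarrow>
    (\<forall>x. f differentiable (at x)) \<and>
    (\<exists>H :: 'a \<Rightarrow> 'a \<Rightarrow>\<^sub>L 'a.
      (\<forall>x. (grad f has_derivative blinfun_apply (H x)) (at x)) \<and> continuous_on UNIV H)"

definition subdifferential :: "('a::real_inner \<Rightarrow> real) \<Rightarrow> 'a \<Rightarrow> 'a set"
  where "subdifferential \<phi> u = {g. \<forall>v. \<phi> v \<ge> \<phi> u + g \<bullet> (v - u)}"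

text \<open>\<open>closest_point (subdifferential \<phi> u) 0\<close> is the element of minimal norm of the
  subdifferential. The last clause is automatic in finite dimension.\<close>

definition damping_potential :: "('a::euclidean_space \<Rightarrow> real) \<Rightarrow> bool"
  where "damping_potential \<phi> \<longleftrightarrow>
    (\<forall>u. \<phi> u \<ge> 0) \<and> convex_on UNIV \<phi> \<and> continuous_on UNIV \<phi> \<and> \<phi> 0 = 0 \<and>
    (\<forall>B. bounded B \<longrightarrow> bounded ((\<lambda>u. closest_point (subdifferential \<phi> u) 0) ` B))"

text \<open>A desingularizing function \<open>\<theta>\<close> only matters on \<open>[0, \<eta>)\<close>; its values elsewhere are
  arbitrary.\<close>

definition desingularizing ::
    "('a::real_inner \<Rightarrow> real) \<Rightarrow> 'a \<Rightarrow> real \<Rightarrow> (real \<Rightarrow> real) \<Rightarrow> bool"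
  where "desingularizing G zbar \<eta> \<theta> \<longleftrightarrow>
    \<eta> > 0 \<and>
    (\<forall>s\<in>{0..<\<eta>}. \<theta> s \<ge> 0) \<and>
    continuous_on {0..<\<eta>} \<theta> \<and> concave_on {0..<\<eta>} \<theta> \<and> mono_on {0..<\<eta>} \<theta> \<and>
    \<theta> 0 = 0 \<and>
    \<theta> C1_differentiable_on {0<..<\<eta>} \<and> (\<forall>s\<in>{0<..<\<eta>}. deriv \<theta> s > 0) \<and>
    (\<exists>U. open U \<and> zbar \<in> U \<and>
      (\<forall>z\<in>U. G zbar < G z \<and> G z < G zbar + \<eta> \<longrightarrow>
        deriv \<theta> (G z - G zbar) * norm (grad G z) \<ge> 1))"

definition KL_property :: "('a::real_inner \<Rightarrow> real) \<Rightarrow> bool"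
  where "KL_property G \<longleftrightarrow>
    (\<forall>z. G differentiable (at z)) \<and>
    (\<forall>zbar. grad G zbar = 0 \<longrightarrow> (\<exists>\<eta> \<theta>. desingularizing G zbar \<eta> \<theta>))"

definition E_fun :: "('a::real_inner \<Rightarrow> real) \<Rightarrow> real \<Rightarrow> 'a \<times> 'a \<Rightarrow> real"
  where "E_fun f l = (\<lambda>(x, u). (norm u)\<^sup>2 / 2 + f x + l * (grad f x \<bullet> u))"

definition F_field :: "('a::real_inner \<Rightarrow> real) \<Rightarrow> ('a \<Rightarrow> real) \<Rightarrow> 'a \<times> 'a \<Rightarrow> 'a \<times> 'a"
  where "F_field f \<phi> = (\<lambda>(x, u). (- u, grad \<phi> u + grad f x))"

text \<open>\<open>x\<close> is a classical solution on \<open>[0, \<infinity>)\<close> with velocity \<open>x'\<close>; derivatives at \<open>0\<close> are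
  one-sided, and the values of \<open>x\<close> and \<open>x'\<close> at negative times are irrelevant.\<close>

definition solution_trajectory ::
    "('a::real_inner \<Rightarrow> real) \<Rightarrow> ('a \<Rightarrow> real) \<Rightarrow> (real \<Rightarrow> 'a) \<Rightarrow> (real \<Rightarrow> 'a) \<Rightarrow> bool"
  where "solution_trajectory f \<phi> x x' \<longleftrightarrow>
    (\<forall>t\<ge>0. (x has_vector_derivative x' t) (at t within {0..})) \<and>
    (\<forall>t\<ge>0. \<exists>x''. (x' has_vector_derivative x'') (at t within {0..}) \<and>
       x'' + grad \<phi> (x' t) + grad f (x t) = 0)"

end

theory Submission
  imports Defs
begin

text \<open>
  Written as a first-order system for \<open>z = (x, x')\<close>, the equation reads \<open>z' = - F(z)\<close>, and the
  mechanical energy \<open>\<bar>u\<bar>\<^sup>2/2 + f(x)\<close> decreases along it at the rate \<open>\<nabla>\<phi>(u) \<bullet> u\<close>. That rate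
  vanishes whenever the velocity does, even far from equilibrium, so the gradient of the mechanical
  energy makes no uniform angle with \<open>F\<close>. The cross term \<open>\<lambda> \<nabla>f(x) \<bullet> u\<close> repairs this: on
  bounded sets with small velocity, and for small \<open>\<lambda>\<close>, the rate of decrease of \<open>E\<^sub>\<lambda>\<close> dominates
  \<open>\<bar>u\<bar>\<^sup>2 + \<bar>\<nabla>f(x)\<bar>\<^sup>2\<close>, while \<open>\<bar>\<nabla>E\<^sub>\<lambda>\<bar>\<close> and \<open>\<bar>F\<bar>\<close> are both at most a multiple of
  \<open>\<bar>u\<bar> + \<bar>\<nabla>f(x)\<bar>\<close>. This is the angle condition, \<open>E_fun_angle\<close>.

  Under an angle condition the Kurdyka--Lojasiewicz inequality bounds length by energy. While the
  curve is in the neighbourhood of a point \<open>zbar\<close> where a desingularizing function \<open>\<theta>\<close> works,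
  \<open>(\<theta>(E - E(zbar)))' = \<theta>'(E - E(zbar)) (\<nabla>E \<bullet> z') \<le> - \<alpha> \<theta>' \<bar>\<nabla>E\<bar> \<bar>z'\<bar> \<le> - \<alpha> \<bar>z'\<bar>\<close>,
  so the length still to come is at most \<open>\<theta>(E - E(zbar)) / \<alpha>\<close>. If \<open>zbar\<close> is a cluster point, the
  curve comes close to it at a time when this bound is already small, and then cannot leave the
  neighbourhood any more: it converges to \<open>zbar\<close> with finite length and the asserted rate. The
  locale \<open>angle_descent\<close> contains this argument, ending in \<open>converges_with_finite_length\<close>.

  To apply it, the trajectory must end up in the region of small velocities, and must have a
  cluster point that is critical for \<open>E\<^sub>\<lambda>\<close>. Both follow from one principle,
  \<open>tendsto_zero_of_dissipation\<close>: a Lipschitz quantity that costs a bounded-below energy a definite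
  amount whenever it is not small must tend to zero. Applied to the mechanical energy, with
  dissipation at least \<open>c \<bar>u\<bar>\<^sup>p\<close>, it gives \<open>x' \<rightarrow> 0\<close>; applied to \<open>E\<^sub>\<lambda>\<close> it gives
  \<open>\<nabla>f(x) \<rightarrow> 0\<close>. Boundedness supplies the cluster point.
\<close>

section \<open>Gradients\<close>

lemma grad_eqI:
  assumes "(f has_derivative (\<lambda>h. h \<bullet> D)) (at x)"
  shows "grad f x = D"
  unfolding grad_def
proof (rule the_equality)
  show "GDERIV f x :> D"
    using assms by (simp add: gderiv_def)
next
  fix D' assume "GDERIV f x :> D'"
  then have "(f has_derivative (\<lambda>h. h \<bullet> D')) (at x)"
    by (simp add: gderiv_def)
  then have "(\<lambda>h. h \<bullet> D') = (\<lambda>h. h \<bullet> D)"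
    using assms has_derivative_unique by blast
  then have "(D' - D) \<bullet> D' = (D' - D) \<bullet> D"
    by metis
  then have "(D' - D) \<bullet> (D' - D) = 0"
    by (simp add: inner_diff_right)
  then show "D' = D" by simp
qed

text \<open>The Riesz representative of the derivative, available in finite dimension as the adjoint applied
  to \<open>1\<close>; hence the definite description in \<open>grad\<close> denotes the gradient at every point of
  differentiability.\<close>

lemma has_derivative_grad:
  fixes f :: "'a::euclidean_space \<Rightarrow> real"
  assumes "f differentiable (at x)"
  shows "(f has_derivative (\<lambda>h. h \<bullet> grad f x)) (at x)"
proof -
  obtain f' where f': "(f has_derivative f') (at x)"
    using assms by (auto simp: differentiable_def)
  have lin: "linear f'"
    using f' has_derivative_linear by blast
  have "f' = (\<lambda>h. h \<bullet> adjoint f' 1)"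
    using adjoint_works[OF lin] by fastforce
  then show ?thesis
    using f' grad_eqI by metis
qed

lemma has_real_derivative_along_curve:
  fixes f :: "'a::euclidean_space \<Rightarrow> real"
  assumes "f differentiable (at (z t))" "(z has_vector_derivative v) (at t)"
  shows "((\<lambda>s. f (z s)) has_real_derivative grad f (z t) \<bullet> v) (at t)"
proof -
  have "((\<lambda>s. f (z s)) has_derivative (\<lambda>h. (h *\<^sub>R v) \<bullet> grad f (z t))) (at t)"
    using has_derivative_compose[OF assms(2)[unfolded has_vector_derivative_def]
        has_derivative_grad[OF assms(1)]] .
  then show ?thesis
    by (simp add: has_field_derivative_def inner_commute mult.commute)
      (metis (no_types, lifting) ext mult.commute)
qed

text \<open>The tangent of the convex function \<open>s \<mapsto> \<phi> (s u)\<close> at \<open>s = 1\<close>, evaluated at \<open>s = 0\<close>, lies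
  below \<open>\<phi> 0\<close>. It turns lower bounds on the potential into lower bounds on the dissipation.\<close>

lemma convex_le_inner_grad:
  fixes \<phi> :: "'a::euclidean_space \<Rightarrow> real"
  assumes conv: "convex_on UNIV \<phi>" and diff: "\<phi> differentiable (at u)" and zero: "\<phi> 0 = 0"
  shows "\<phi> u \<le> grad \<phi> u \<bullet> u"
proof -
  let ?g = "\<lambda>s::real. \<phi> (s *\<^sub>R u)"
  have "convex_on UNIV ?g"
  proof (rule convex_onI)
    fix t a b :: real assume "0 < t" "t < 1"
    then have "\<phi> ((1 - t) *\<^sub>R (a *\<^sub>R u) + t *\<^sub>R (b *\<^sub>R u))
        \<le> (1 - t) * \<phi> (a *\<^sub>R u) + t * \<phi> (b *\<^sub>R u)"
      using convex_onD[OF conv, of t "a *\<^sub>R u" "b *\<^sub>R u"] by simp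
    then show "\<phi> (((1 - t) *\<^sub>R a + t *\<^sub>R b) *\<^sub>R u)
        \<le> (1 - t) * \<phi> (a *\<^sub>R u) + t * \<phi> (b *\<^sub>R u)"
      by (simp add: scaleR_add_left)
  qed simp
  moreover have "(?g has_real_derivative grad \<phi> u \<bullet> u) (at 1)"
  proof -
    have "((\<lambda>s::real. s *\<^sub>R u) has_vector_derivative u) (at 1)"
      by (auto intro!: derivative_eq_intros)
    then show ?thesis
      using has_real_derivative_along_curve[of \<phi> "\<lambda>s. s *\<^sub>R u" 1 u] diff by simp
  qed
  ultimately have "?g 0 - ?g 1 \<ge> grad \<phi> u \<bullet> u * (0 - 1)"
    by (intro convex_on_imp_above_tangent[where A=UNIV]) auto
  then show ?thesis
    by (simp add: zero)
qed

lemma norm_adjoint_blinfun_le: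
  fixes A :: "'a::euclidean_space \<Rightarrow>\<^sub>L 'b::euclidean_space"
  shows "norm (adjoint (blinfun_apply A) u) \<le> norm A * norm u"
proof -
  let ?v = "adjoint (blinfun_apply A) u"
  have "norm ?v * norm ?v = ?v \<bullet> ?v"
    by (simp add: norm_eq_sqrt_inner)
  also have "\<dots> = blinfun_apply A ?v \<bullet> u"
    by (simp add: adjoint_works blinfun.bounded_linear_right bounded_linear.linear)
  also have "\<dots> \<le> norm (blinfun_apply A ?v) * norm u"
    by (rule norm_cauchy_schwarz)
  also have "\<dots> \<le> norm A * norm ?v * norm u"
    by (intro mult_right_mono norm_blinfun) auto
  finally have "norm ?v * norm ?v \<le> (norm A * norm u) * norm ?v"
    by (simp add: mult_ac)
  then show ?thesis
    by (cases "norm ?v = 0") (auto simp: mult_le_cancel_right)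
qed

lemma nonincreasing_of_deriv_nonpos:
  fixes h :: "real \<Rightarrow> real"
  assumes "\<And>t. T \<le> t \<Longrightarrow> (h has_real_derivative h' t) (at t)"
    and "\<And>t. T \<le> t \<Longrightarrow> h' t \<le> 0" and "T \<le> s" "s \<le> t"
  shows "h t \<le> h s"
  using DERIV_nonpos_imp_nonincreasing[of s t h] assms by (meson order_trans)

section \<open>Dissipation forces convergence to zero\<close>

text \<open>A form of Barbalat's lemma. If \<open>\<bar>y\<bar> \<ge> e\<close> happened at arbitrarily late times, the Lipschitz
  bound would keep \<open>\<bar>y\<bar> \<ge> e/2\<close> on time windows of a fixed length, and each window would lower
  \<open>h\<close> by a fixed amount, which is impossible once \<open>h\<close> is within that amount of its infimum.\<close>

lemma tendsto_zero_of_dissipation: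
  fixes h :: "real \<Rightarrow> real" and y :: "real \<Rightarrow> 'a::real_normed_vector"
  assumes deriv: "\<And>t. T \<le> t \<Longrightarrow> (h has_real_derivative h' t) (at t)"
    and dissip: "\<And>t. T \<le> t \<Longrightarrow> h' t \<le> - \<omega> (norm (y t))"
    and bdd: "\<And>t. T \<le> t \<Longrightarrow> m \<le> h t"
    and lip: "K-lipschitz_on {T..} y"
    and mono: "\<And>r s. 0 \<le> r \<Longrightarrow> r \<le> s \<Longrightarrow> \<omega> r \<le> \<omega> s"
    and nonneg: "0 \<le> \<omega> 0" and pos: "\<And>r. 0 < r \<Longrightarrow> 0 < \<omega> r"
  shows "(y \<longlongrightarrow> 0) at_top"
proof (rule ccontr)
  assume "\<not> (y \<longlongrightarrow> 0) at_top"
  then obtain e where e: "e > 0" and often: "\<And>S. \<exists>t\<ge>S. e \<le> norm (y t)"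
    unfolding tendsto_iff eventually_at_top_linorder by (force simp: not_less)
  \<comment> \<open>The window length; \<open>K + 1\<close> instead of \<open>K\<close> avoids a division by zero for constant \<open>y\<close>.\<close>
  define \<tau> where "\<tau> = e / (2 * (K + 1))"
  have K: "K \<ge> 0" using lip by (rule lipschitz_on_nonneg)
  have \<tau>: "\<tau> > 0" "K * \<tau> \<le> e / 2"
    using e K by (auto simp: \<tau>_def field_simps)
  define d where "d = \<tau> * \<omega> (e / 2)"
  have d: "d > 0" using \<tau> pos e by (simp add: d_def)
  have h'_nonpos: "h' t \<le> 0" if "T \<le> t" for t
    using dissip[OF that] mono[of 0 "norm (y t)"] nonneg by auto
  have bb: "bdd_below (h ` {T..})"
    using bdd by (intro bdd_belowI2[of _ m]) auto
  have "Inf (h ` {T..}) < Inf (h ` {T..}) + d" using d by simp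
  then obtain t1 where t1: "T \<le> t1" "h t1 < Inf (h ` {T..}) + d"
    using cInf_lessD[of "h ` {T..}"] by (metis atLeast_iff empty_iff imageE image_is_empty order_refl)
  obtain t where t: "t1 \<le> t" "e \<le> norm (y t)" using often by blast
  have "t < t + \<tau>" using \<tau> by simp
  then obtain s where s: "t < s" "s < t + \<tau>" "h (t + \<tau>) - h t = (t + \<tau> - t) * h' s"
    using MVT2[of t "t + \<tau>" h h'] deriv t t1 by (smt (verit) order_trans)
  have "dist (y t) (y s) \<le> K * dist t s"
    using lipschitz_onD[OF lip] s t t1 by auto
  also have "\<dots> \<le> K * \<tau>"
    using s K by (intro mult_left_mono) (auto simp: dist_real_def)
  finally have "norm (y t) - norm (y s) \<le> e / 2"
    using \<tau> norm_triangle_ineq2[of "y t" "y s"] by (simp add: dist_norm)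
  then have "e / 2 \<le> norm (y s)" using t by (simp add: field_simps)
  then have "h' s \<le> - \<omega> (e / 2)"
    using dissip[of s] mono[of "e / 2" "norm (y s)"] e s t t1 by auto
  then have "h (t + \<tau>) \<le> h t - d"
    using s \<tau> mult_left_mono[of "h' s" "- \<omega> (e / 2)" \<tau>] by (simp add: d_def)
  also have "h t \<le> h t1"
    using nonincreasing_of_deriv_nonpos[OF deriv h'_nonpos t1(1) t(1)] .
  finally have "h (t + \<tau>) < Inf (h ` {T..})" using t1 by simp
  moreover have "Inf (h ` {T..}) \<le> h (t + \<tau>)"
    using t t1 \<tau> by (intro cInf_lower bb) auto
  ultimately show False by simp
qed

section \<open>Descent curves satisfying an angle condition\<close>

text \<open>Here \<open>V\<close> is the velocity of the curve \<open>z\<close>, and \<open>G\<close> is a strict Lyapunov function for it. The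
  condition \<open>strict\<close> says more than \<open>angle\<close> at critical points of \<open>G\<close>, where the angle
  condition holds for any velocity: it makes the curve stop there.\<close>

locale angle_descent =
  fixes G :: "'a::euclidean_space \<Rightarrow> real" and z V :: "real \<Rightarrow> 'a" and \<alpha> T :: real
  assumes \<alpha>_pos: "\<alpha> > 0"
    and G_diff: "\<And>w. G differentiable (at w)"
    and z_deriv: "\<And>t. T \<le> t \<Longrightarrow> (z has_vector_derivative V t) (at t)"
    and V_cont: "continuous_on {T..} V"
    and angle: "\<And>t. T \<le> t \<Longrightarrow> \<alpha> * norm (grad G (z t)) * norm (V t) \<le> - (grad G (z t) \<bullet> V t)"
    and strict: "\<And>t. T \<le> t \<Longrightarrow> grad G (z t) \<bullet> V t = 0 \<Longrightarrow> V t = 0"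
begin

lemma value_deriv:
  "T \<le> t \<Longrightarrow> ((\<lambda>s. G (z s)) has_real_derivative grad G (z t) \<bullet> V t) (at t)"
  by (intro has_real_derivative_along_curve G_diff z_deriv)

lemma value_deriv_nonpos: "T \<le> t \<Longrightarrow> grad G (z t) \<bullet> V t \<le> 0"
  using angle[of t] \<alpha>_pos by (smt (verit) mult_nonneg_nonneg norm_ge_zero)

lemma value_antimono: "T \<le> s \<Longrightarrow> s \<le> t \<Longrightarrow> G (z t) \<le> G (z s)"
  using nonincreasing_of_deriv_nonpos[OF value_deriv value_deriv_nonpos] .

lemma value_continuous: "continuous_on {T..} (\<lambda>s. G (z s))"
  using value_deriv by (intro continuous_at_imp_continuous_on) (auto intro: DERIV_isCont)

lemma z_continuous: "continuous_on {T..} z"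
  using z_deriv by (intro continuous_at_imp_continuous_on)
    (auto intro: has_vector_derivative_continuous)

lemma speed_integrable: "T \<le> a \<Longrightarrow> (\<lambda>t. norm (V t)) integrable_on {a..b}"
  by (intro integrable_continuous_interval continuous_on_norm continuous_on_subset[OF V_cont]) auto

lemma distance_le_length:
  assumes "T \<le> a" "a \<le> b"
  shows "norm (z b - z a) \<le> integral {a..b} (\<lambda>t. norm (V t))"
proof -
  have "(V has_integral (z b - z a)) {a..b}"
    using assms z_deriv
    by (intro fundamental_theorem_of_calculus) (auto intro: has_vector_derivative_at_within)
  then show ?thesis
    using integral_norm_bound_integral[of V "{a..b}" "\<lambda>t. norm (V t)"] speed_integrable assms
    by (metis has_integral_integrable_integral order_refl)
qed

lemma speed_integral_combine:
  assumes "T \<le> a" "a \<le> b" "b \<le> c"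
  shows "integral {a..b} (\<lambda>t. norm (V t)) + integral {b..c} (\<lambda>t. norm (V t))
    = integral {a..c} (\<lambda>t. norm (V t))"
  using assms by (intro Henstock_Kurzweil_Integration.integral_combine speed_integrable) auto

text \<open>Once the critical value is reached, \<open>\<theta>\<close> gives no information, as its derivative at \<open>0\<close> need
  not exist. By strictness the curve is then at rest.\<close>

lemma length_zero_on_level:
  assumes "T \<le> a" "a \<le> b" and const: "\<And>t. a < t \<Longrightarrow> t < b \<Longrightarrow> G (z t) = e"
  shows "integral {a..b} (\<lambda>t. norm (V t)) = 0"
proof -
  have "V t = 0" if t: "t \<in> {a<..<b}" for t
  proof (rule strict)
    show "T \<le> t" using t assms by auto
    have "((\<lambda>s. G (z s)) has_real_derivative 0) (at t)"
      by (rule has_field_derivative_transform_within_open[of "\<lambda>_. e" _ _ "{a<..<b}"])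
        (use t const in auto)
    then show "grad G (z t) \<bullet> V t = 0"
      using value_deriv[OF \<open>T \<le> t\<close>] DERIV_unique by blast
  qed
  then have "integral {a<..<b} (\<lambda>t. norm (V t)) = integral {a<..<b} (\<lambda>t. 0)"
    by (intro Henstock_Kurzweil_Integration.integral_cong) auto
  then show ?thesis
    by (simp add: integral_open_interval_real)
qed

text \<open>The sum of \<open>\<theta>(G - G zbar)\<close> and \<open>\<alpha>\<close> times the length run so far is nonincreasing. The
  hypotheses on intermediate points concern only the interior of the interval, so that the curve
  may leave the neighbourhood, or reach the value \<open>G zbar\<close>, at the final time.\<close>

lemma length_le_above_level:
  assumes ab: "T \<le> a" "a \<le> b" and des: "desingularizing G zbar \<eta> \<theta>"
    and kl: "\<And>r. a < r \<Longrightarrow> r < b \<Longrightarrow>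
      1 \<le> deriv \<theta> (G (z r) - G zbar) * norm (grad G (z r))"
    and above: "\<And>r. a < r \<Longrightarrow> r < b \<Longrightarrow> G zbar < G (z r)"
    and top: "G (z a) < G zbar + \<eta>" and bot: "G zbar \<le> G (z b)"
  shows "\<alpha> * integral {a..b} (\<lambda>t. norm (V t))
    \<le> \<theta> (G (z a) - G zbar) - \<theta> (G (z b) - G zbar)"
proof -
  let ?w = "\<lambda>r. G (z r) - G zbar"
  let ?J = "\<lambda>r. \<theta> (?w r) + \<alpha> * integral {a..r} (\<lambda>t. norm (V t))"
  have range: "?w r \<in> {0..<\<eta>}" if "r \<in> {a..b}" for r
    using value_antimono[of a r] value_antimono[of r b] that ab top bot by auto
  have Vc: "continuous_on {a..b} (\<lambda>t. norm (V t))"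
    using ab by (intro continuous_on_norm continuous_on_subset[OF V_cont]) auto
  have "?J b \<le> ?J a"
  proof (rule DERIV_nonpos_imp_decreasing_open[OF ab(2)])
    have "continuous_on {a..b} ?w"
      using ab by (intro continuous_intros continuous_on_subset[OF value_continuous]) auto
    then have "continuous_on {a..b} (\<lambda>r. \<theta> (?w r))"
      using des range unfolding desingularizing_def
      by (intro continuous_on_compose2[of "{0..<\<eta>}" \<theta> "{a..b}" ?w]) auto
    then show "continuous_on {a..b} ?J"
      using indefinite_integral_continuous_1[OF integrable_continuous_interval[OF Vc]]
      by (intro continuous_on_add continuous_on_mult continuous_on_const)
  next
    fix r assume r: "a < r" "r < b"
    have T: "T \<le> r" using r ab by simp
    have w: "?w r \<in> {0<..<\<eta>}" using range[of r] above[of r] r by auto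
    obtain D where "(\<theta> has_real_derivative D) (at (?w r))"
      using des w unfolding desingularizing_def C1_differentiable_on_def
      by (metis has_real_derivative_iff_has_vector_derivative)
    then have "(\<theta> has_real_derivative deriv \<theta> (?w r)) (at (?w r))"
      using DERIV_imp_deriv by metis
    moreover have "(?w has_real_derivative grad G (z r) \<bullet> V r) (at r)"
      using value_deriv[OF T] by (auto intro!: derivative_eq_intros)
    ultimately have "((\<lambda>r. \<theta> (?w r)) has_real_derivative
        deriv \<theta> (?w r) * (grad G (z r) \<bullet> V r)) (at r)"
      by (rule DERIV_chain2)
    moreover have "((\<lambda>r. integral {a..r} (\<lambda>t. norm (V t))) has_real_derivative norm (V r)) (at r)"
      using integral_has_real_derivative[OF Vc, of r] r by (simp add: at_within_Icc_at)
    ultimately have D: "(?J has_real_derivative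
        deriv \<theta> (?w r) * (grad G (z r) \<bullet> V r) + \<alpha> * norm (V r)) (at r)"
      by (intro DERIV_add DERIV_cmult)
    have pos: "deriv \<theta> (?w r) > 0" using des w unfolding desingularizing_def by blast
    have "\<alpha> * norm (V r) * 1 \<le> \<alpha> * norm (V r) * (deriv \<theta> (?w r) * norm (grad G (z r)))"
      using kl[OF r] \<alpha>_pos by (intro mult_left_mono) auto
    also have "\<dots> = deriv \<theta> (?w r) * (\<alpha> * norm (grad G (z r)) * norm (V r))"
      by simp
    also have "\<dots> \<le> deriv \<theta> (?w r) * (- (grad G (z r) \<bullet> V r))"
      using angle[OF T] pos by (intro mult_left_mono) auto
    finally have "deriv \<theta> (?w r) * (grad G (z r) \<bullet> V r) + \<alpha> * norm (V r) \<le> 0"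
      by simp
    with D show "\<exists>y. (?J has_real_derivative y) (at r) \<and> y \<le> 0" by blast
  qed
  then show ?thesis by simp
qed

text \<open>The value \<open>G zbar\<close> may be attained at a finite time: up to the first such time
  \<open>length_le_above_level\<close> applies, and afterwards the curve does not move.\<close>

lemma length_le_desingularized:
  assumes ab: "T \<le> a" "a \<le> b" and des: "desingularizing G zbar \<eta> \<theta>"
    and kl: "\<And>r. a < r \<Longrightarrow> r < b \<Longrightarrow> G zbar < G (z r) \<Longrightarrow>
      1 \<le> deriv \<theta> (G (z r) - G zbar) * norm (grad G (z r))"
    and top: "G (z a) < G zbar + \<eta>" and bot: "G zbar \<le> G (z b)"
  shows "\<alpha> * integral {a..b} (\<lambda>t. norm (V t))
    \<le> \<theta> (G (z a) - G zbar) - \<theta> (G (z b) - G zbar)"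
proof (cases "G zbar < G (z b)")
  case True
  then have above: "G zbar < G (z r)" if "a < r" "r < b" for r
    using value_antimono[of r b] that ab by auto
  show ?thesis
    by (rule length_le_above_level[OF ab des kl]) (use above top bot in auto)
next
  case False
  then have Gb: "G (z b) = G zbar" using bot by simp
  let ?S = "{r\<in>{a..b}. G (z r) = G zbar}"
  have "closed ?S"
    using ab by (intro continuous_closed_preimage_constant continuous_on_subset[OF value_continuous]) auto
  moreover have "b \<in> ?S" using ab Gb by simp
  ultimately have "Inf ?S \<in> ?S"
    by (intro closed_contains_Inf) (auto intro: bdd_belowI[of _ a])
  then obtain c where c: "c \<in> {a..b}" "G (z c) = G zbar" and c_Inf: "c = Inf ?S" by auto
  have c_least: "c \<le> r" if "r \<in> ?S" for r
    unfolding c_Inf using that by (intro cInf_lower bdd_belowI[of _ a]) auto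
  have above: "G zbar < G (z r)" if "a < r" "r < c" for r
    using value_antimono[of r b] Gb c_least[of r] that c ab by fastforce
  have "\<alpha> * integral {a..c} (\<lambda>t. norm (V t))
      \<le> \<theta> (G (z a) - G zbar) - \<theta> (G (z c) - G zbar)"
    using ab c top above by (intro length_le_above_level[OF _ _ des]) (auto intro!: kl)
  moreover have "integral {c..b} (\<lambda>t. norm (V t)) = 0"
  proof (rule length_zero_on_level)
    show "G (z t) = G zbar" if "c < t" "t < b" for t
      using value_antimono[of t b] value_antimono[of c t] Gb c that ab by auto
  qed (use ab c in auto)
  ultimately show ?thesis
    using speed_integral_combine[of a c b] ab c Gb by auto
qed

text \<open>Since \<open>G\<close> decreases along the curve and comes back close to \<open>G zbar\<close> at arbitrarily late times,
  it can neither fall below that value nor converge to another one.\<close>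

lemma cluster_value_le:
  assumes cluster: "\<forall>\<rho>>0. \<forall>S. \<exists>t\<ge>S. dist (z t) zbar < \<rho>" and t: "T \<le> t"
  shows "G zbar \<le> G (z t)"
proof (rule ccontr)
  assume less: "\<not> G zbar \<le> G (z t)"
  have "isCont G zbar"
    using G_diff differentiable_imp_continuous_within by blast
  then obtain \<rho> where \<rho>: "\<rho> > 0"
    and near: "\<And>w. dist w zbar < \<rho> \<Longrightarrow> dist (G w) (G zbar) < G zbar - G (z t)"
    using less unfolding continuous_at_eps_delta by (metis diff_gt_0_iff_gt not_le)
  obtain s where s: "t \<le> s" "dist (z s) zbar < \<rho>" using cluster \<rho> by blast
  show False
    using near[OF s(2)] value_antimono[OF t s(1)] by (simp add: dist_real_def)
qed

lemma value_tendsto_cluster_value: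
  assumes cluster: "\<forall>\<rho>>0. \<forall>S. \<exists>t\<ge>S. dist (z t) zbar < \<rho>"
  shows "((\<lambda>t. G (z t)) \<longlongrightarrow> G zbar) at_top"
proof (rule tendstoI)
  fix e :: real assume "e > 0"
  have "isCont G zbar"
    using G_diff differentiable_imp_continuous_within by blast
  then obtain \<rho> where "\<rho> > 0" and near: "\<And>w. dist w zbar < \<rho> \<Longrightarrow> dist (G w) (G zbar) < e"
    using \<open>e > 0\<close> unfolding continuous_at_eps_delta by metis
  then obtain s where s: "T \<le> s" "dist (z s) zbar < \<rho>" using cluster by blast
  show "\<forall>\<^sub>F t in at_top. dist (G (z t)) (G zbar) < e"
    using eventually_ge_at_top[of s]
  proof eventually_elim
    case (elim t)
    then show ?case
      using near[OF s(2)] value_antimono[OF s(1) elim] cluster_value_le[OF cluster, of t] s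
      by (auto simp: dist_real_def)
  qed
qed

text \<open>The trapping argument: from a time when the curve is within \<open>\<rho>/2\<close> of \<open>zbar\<close> and the length
  bound is below \<open>\<rho>/2\<close>, the curve cannot reach the sphere of radius \<open>\<rho>\<close>, because up to the
  first time of doing so the length bound would be valid and forbid it.\<close>

theorem converges_with_finite_length:
  assumes des: "desingularizing G zbar \<eta> \<theta>"
    and cluster: "\<forall>\<rho>>0. \<forall>S. \<exists>t\<ge>S. dist (z t) zbar < \<rho>"
  shows "(z \<longlongrightarrow> zbar) at_top"
    and "\<forall>\<^sub>F a in at_top. G (z a) - G zbar \<in> {0..<\<eta>} \<and>
      (\<forall>b\<ge>a. integral {a..b} (\<lambda>t. norm (V t)) \<le> 1 / \<alpha> * \<theta> (G (z a) - G zbar)) \<and>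
      norm (z a - zbar) \<le> 1 / \<alpha> * \<theta> (G (z a) - G zbar)"
proof -
  note above = cluster_value_le[OF cluster]
  note lim = value_tendsto_cluster_value[OF cluster]
  have \<eta>: "\<eta> > 0" and \<theta>_nonneg: "\<And>s. s \<in> {0..<\<eta>} \<Longrightarrow> \<theta> s \<ge> 0" and \<theta>0: "\<theta> 0 = 0"
    and \<theta>_cont: "continuous_on {0..<\<eta>} \<theta>"
    using des unfolding desingularizing_def by auto
  obtain U where U: "open U" "zbar \<in> U" and kl: "\<And>w. w \<in> U \<Longrightarrow> G zbar < G w \<Longrightarrow>
      G w < G zbar + \<eta> \<Longrightarrow> 1 \<le> deriv \<theta> (G w - G zbar) * norm (grad G w)"
    using des unfolding desingularizing_def by blast
  have value_range: "\<forall>\<^sub>F t in at_top. T \<le> t \<and> G (z t) - G zbar \<in> {0..<\<eta>}"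
  proof -
    have "\<forall>\<^sub>F t in at_top. G (z t) < G zbar + \<eta>"
      using \<eta> by (intro order_tendstoD(2)[OF lim]) auto
    with eventually_ge_at_top[of T] show ?thesis
      by eventually_elim (use above in auto)
  qed
  have \<theta>_lim: "((\<lambda>t. \<theta> (G (z t) - G zbar)) \<longlongrightarrow> 0) at_top"
  proof -
    have "((\<lambda>t. G (z t) - G zbar) \<longlongrightarrow> 0) at_top"
      using lim by (simp add: LIM_zero)
    then have "((\<lambda>t. \<theta> (G (z t) - G zbar)) \<longlongrightarrow> \<theta> 0) at_top"
      by (rule continuous_on_tendsto_compose[OF \<theta>_cont])
        (use \<eta> value_range in \<open>auto elim: eventually_mono\<close>)
    then show ?thesis by (simp add: \<theta>0)
  qed
  have bound: "integral {a..b} (\<lambda>t. norm (V t)) \<le> 1 / \<alpha> * \<theta> (G (z a) - G zbar)"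
    if ab: "T \<le> a" "a \<le> b" and w: "G (z a) - G zbar \<in> {0..<\<eta>}"
      and inU: "\<And>r. a < r \<Longrightarrow> r < b \<Longrightarrow> z r \<in> U" for a b
  proof -
    have "\<alpha> * integral {a..b} (\<lambda>t. norm (V t))
        \<le> \<theta> (G (z a) - G zbar) - \<theta> (G (z b) - G zbar)"
    proof (rule length_le_desingularized[OF ab des])
      fix r assume r: "a < r" "r < b" "G zbar < G (z r)"
      show "1 \<le> deriv \<theta> (G (z r) - G zbar) * norm (grad G (z r))"
        using value_antimono[of a r] w ab r inU by (intro kl) auto
    qed (use w ab above in auto)
    also have "\<dots> \<le> \<theta> (G (z a) - G zbar)"
      using \<theta>_nonneg[of "G (z b) - G zbar"] value_antimono[of a b] above[of b] ab w by auto
    finally show ?thesis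
      using \<alpha>_pos by (simp add: field_simps)
  qed
  have trapped: "\<forall>\<^sub>F t in at_top. z t \<in> ball zbar \<rho>"
    if \<rho>: "\<rho> > 0" and sub: "ball zbar \<rho> \<subseteq> U" for \<rho>
  proof -
    have "\<forall>\<^sub>F t in at_top. \<theta> (G (z t) - G zbar) < \<alpha> * (\<rho> / 2)"
      using \<alpha>_pos \<rho> by (intro order_tendstoD(2)[OF \<theta>_lim]) auto
    then obtain S where S: "\<And>t. t \<ge> S \<Longrightarrow> T \<le> t \<and> G (z t) - G zbar \<in> {0..<\<eta>} \<and>
        \<theta> (G (z t) - G zbar) < \<alpha> * (\<rho> / 2)"
      using value_range eventually_conj unfolding eventually_at_top_linorder
      by (metis (no_types, lifting) linorder_le_cases order.trans)
    obtain a where a: "S \<le> a" "dist (z a) zbar < \<rho> / 2"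
      using cluster half_gt_zero[OF \<rho>] by blast
    have Ta: "T \<le> a" using S a by auto
    have "z t \<in> ball zbar \<rho>" if "a \<le> t" for t
    proof (rule ccontr)
      assume "z t \<notin> ball zbar \<rho>"
      let ?B = "{r \<in> {a..t}. z r \<in> - ball zbar \<rho>}"
      have "closed ?B"
        using Ta by (intro continuous_closed_preimage[unfolded vimage_def Int_def, simplified]
            continuous_on_subset[OF z_continuous]) auto
      moreover have "t \<in> ?B" using that \<open>z t \<notin> ball zbar \<rho>\<close> by simp
      ultimately have "Inf ?B \<in> ?B"
        by (intro closed_contains_Inf) (auto intro: bdd_belowI[of _ a])
      \<comment> \<open>The first exit time from the ball.\<close>
      then obtain b where b: "a \<le> b" "z b \<notin> ball zbar \<rho>" "b \<le> t" and b_Inf: "b = Inf ?B"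
        by auto
      have inside: "z r \<in> U" if "a < r" "r < b" for r
      proof (rule ccontr)
        assume "z r \<notin> U"
        then have "r \<in> ?B" using sub that b by auto
        then have "b \<le> r" unfolding b_Inf by (intro cInf_lower bdd_belowI[of _ a]) auto
        with that show False by simp
      qed
      have "norm (z b - z a) \<le> integral {a..b} (\<lambda>t. norm (V t))"
        using distance_le_length Ta b by blast
      also have "\<dots> \<le> 1 / \<alpha> * \<theta> (G (z a) - G zbar)"
        using bound[OF Ta b(1)] inside S a by blast
      also have "\<dots> < \<rho> / 2"
        using S[OF a(1)] \<alpha>_pos by (simp add: field_simps)
      finally have "dist (z b) (z a) < \<rho> / 2" by (simp add: dist_norm)
      then have "dist (z b) zbar < \<rho>"
        using a dist_triangle[of "z b" zbar "z a"] by simp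
      then show False using b by (simp add: dist_commute)
    qed
    then show ?thesis unfolding eventually_at_top_linorder by blast
  qed
  obtain \<rho>0 where \<rho>0: "\<rho>0 > 0" "ball zbar \<rho>0 \<subseteq> U"
    using U open_contains_ball by blast
  show lim_z: "(z \<longlongrightarrow> zbar) at_top"
  proof (rule tendstoI)
    fix \<rho> :: real assume "\<rho> > 0"
    then have "\<forall>\<^sub>F t in at_top. z t \<in> ball zbar (min \<rho> \<rho>0)"
      using \<rho>0 by (intro trapped) auto
    then show "\<forall>\<^sub>F t in at_top. dist (z t) zbar < \<rho>"
      by eventually_elim (auto simp: dist_commute)
  qed
  obtain S where S: "\<And>t. t \<ge> S \<Longrightarrow> z t \<in> U"
    using trapped[OF \<rho>0] \<rho>0 unfolding eventually_at_top_linorder by blast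
  show "\<forall>\<^sub>F a in at_top. G (z a) - G zbar \<in> {0..<\<eta>} \<and>
      (\<forall>b\<ge>a. integral {a..b} (\<lambda>t. norm (V t)) \<le> 1 / \<alpha> * \<theta> (G (z a) - G zbar)) \<and>
      norm (z a - zbar) \<le> 1 / \<alpha> * \<theta> (G (z a) - G zbar)"
    using value_range eventually_ge_at_top[of S]
  proof eventually_elim
    case (elim a)
    let ?B = "1 / \<alpha> * \<theta> (G (z a) - G zbar)"
    have len: "integral {a..b} (\<lambda>t. norm (V t)) \<le> ?B" if "a \<le> b" for b
      using bound[of a b] S elim that by auto
    have "norm (zbar - z a) \<le> ?B"
    proof (rule Lim_norm_ubound)
      show "((\<lambda>b. z b - z a) \<longlongrightarrow> zbar - z a) at_top"
        by (intro tendsto_intros lim_z)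
      show "\<forall>\<^sub>F b in at_top. norm (z b - z a) \<le> ?B"
        using eventually_ge_at_top[of a]
        by eventually_elim (use distance_le_length len elim in \<open>blast intro: order_trans\<close>)
    qed simp
    then show ?case using elim len by (auto simp: norm_minus_commute)
  qed
qed

end

section \<open>The modified energy and the damped system\<close>

lemma E_fun_has_derivative:
  fixes f :: "'a::euclidean_space \<Rightarrow> real" and H :: "'a \<Rightarrow>\<^sub>L 'a"
  assumes "f differentiable (at x)" and H: "(grad f has_derivative blinfun_apply H) (at x)"
  shows "(E_fun f l has_derivative
    (\<lambda>h. h \<bullet> (grad f x + l *\<^sub>R adjoint (blinfun_apply H) u, u + l *\<^sub>R grad f x))) (at (x, u))"
proof -
  have f: "((\<lambda>z. f (fst z)) has_derivative (\<lambda>h. fst h \<bullet> grad f x)) (at (x, u))"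
    using has_derivative_compose[OF has_derivative_fst[OF has_derivative_ident], of f]
      has_derivative_grad[OF assms(1)] by auto
  have g: "((\<lambda>z. grad f (fst z)) has_derivative (\<lambda>h. blinfun_apply H (fst h))) (at (x, u))"
    using has_derivative_compose[OF has_derivative_fst[OF has_derivative_ident], of "grad f"] H
    by auto
  have adj: "h \<bullet> adjoint (blinfun_apply H) u = blinfun_apply H h \<bullet> u" for h
    by (simp add: adjoint_works blinfun.bounded_linear_right bounded_linear.linear)
  have E: "E_fun f l = (\<lambda>z. (snd z \<bullet> snd z) / 2 + f (fst z) + l * (grad f (fst z) \<bullet> snd z))"
    by (auto simp: E_fun_def power2_norm_eq_inner)
  show ?thesis
    unfolding E
    by (rule derivative_eq_intros f g refl | simp)+
      (simp add: fun_eq_iff inner_prod_def inner_add_right inner_commute adj algebra_simps)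
qed

text \<open>In \<open>\<nabla>E\<^sub>\<lambda> \<bullet> F = \<nabla>\<phi>(u) \<bullet> u - \<lambda> H u \<bullet> u + \<lambda> \<nabla>f \<bullet> \<nabla>\<phi>(u) + \<lambda> \<bar>\<nabla>f\<bar>\<^sup>2\<close> the two terms without a
  sign are absorbed: the Hessian term by \<open>\<gamma> \<bar>u\<bar>\<^sup>2\<close> for small \<open>\<lambda>\<close>, and the mixed term, by
  Young's inequality, half by \<open>\<lambda> \<bar>\<nabla>f\<bar>\<^sup>2\<close> and the rest again by \<open>\<gamma> \<bar>u\<bar>\<^sup>2\<close>. In the constant
  of the angle condition, the two factors of the denominator bound \<open>\<bar>\<nabla>E\<^sub>\<lambda>\<bar>\<close> and \<open>\<bar>F\<bar>\<close> by
  \<open>\<bar>u\<bar> + \<bar>\<nabla>f\<bar>\<close>, and the \<open>4\<close> combines the two halves in the coercive bound with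
  \<open>(a + b)\<^sup>2 \<le> 2 (a\<^sup>2 + b\<^sup>2)\<close>.\<close>

lemma E_fun_angle:
  fixes f \<phi> :: "'a::euclidean_space \<Rightarrow> real" and H :: "'a \<Rightarrow>\<^sub>L 'a"
  assumes f: "f differentiable (at x)" "(grad f has_derivative blinfun_apply H) (at x)"
    and M: "norm H \<le> M"
    and \<phi>: "\<gamma> * (norm u)\<^sup>2 \<le> grad \<phi> u \<bullet> u" "norm (grad \<phi> u) \<le> \<delta> * norm u"
    and pos: "\<gamma> > 0" "\<delta> > 0" "l > 0" and small: "l * (2 * M + \<delta>\<^sup>2) \<le> \<gamma>"
  shows "\<gamma> / 2 * (norm u)\<^sup>2 + l / 2 * (norm (grad f x))\<^sup>2
      \<le> grad (E_fun f l) (x, u) \<bullet> F_field f \<phi> (x, u)" (is ?coercive)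
    and "min \<gamma> l / (4 * ((1 + l + l * M) * (1 + \<delta>))) *
        norm (grad (E_fun f l) (x, u)) * norm (F_field f \<phi> (x, u))
      \<le> grad (E_fun f l) (x, u) \<bullet> F_field f \<phi> (x, u)" (is ?angle)
proof -
  define g where "g = grad f x"
  define w where "w = grad \<phi> u"
  define A where "A = adjoint (blinfun_apply H) u"
  let ?E = "grad (E_fun f l) (x, u)" and ?F = "F_field f \<phi> (x, u)"
  let ?C = "(1 + l + l * M) * (1 + \<delta>)"
  have M0: "M \<ge> 0" using M norm_ge_zero order_trans by blast
  have E: "?E = (g + l *\<^sub>R A, u + l *\<^sub>R g)"
    unfolding g_def A_def by (intro grad_eqI E_fun_has_derivative f)
  have F: "?F = (- u, w + g)" by (simp add: F_field_def w_def g_def)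
  have A: "norm A \<le> M * norm u"
    unfolding A_def using norm_adjoint_blinfun_le[of H u] M mult_right_mono[OF M, of "norm u"]
    by simp
  have "A \<bullet> u \<le> norm A * norm u" by (rule norm_cauchy_schwarz)
  also have "\<dots> \<le> M * (norm u)\<^sup>2"
    using A mult_right_mono[OF A, of "norm u"] by (simp add: power2_eq_square mult_ac)
  finally have Au: "l * (A \<bullet> u) \<le> l * (M * (norm u)\<^sup>2)" using pos by simp
  have "- (g \<bullet> w) \<le> norm g * norm w"
    using norm_cauchy_schwarz[of "- g" w] by simp
  also have "\<dots> \<le> norm g * (\<delta> * norm u)"
    using \<phi> by (intro mult_left_mono) (auto simp: w_def)
  also have "\<dots> \<le> (norm g)\<^sup>2 / 2 + \<delta>\<^sup>2 / 2 * (norm u)\<^sup>2"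
    using sum_squares_bound[of "norm g" "\<delta> * norm u"] by (simp add: power_mult_distrib)
  finally have gw: "l * (- (g \<bullet> w)) \<le> l * ((norm g)\<^sup>2 / 2 + \<delta>\<^sup>2 / 2 * (norm u)\<^sup>2)"
    using pos by (intro mult_left_mono) auto
  have "?E \<bullet> ?F = w \<bullet> u - l * (A \<bullet> u) + l * (g \<bullet> w) + l * (norm g)\<^sup>2"
    by (simp add: E F inner_add_left inner_add_right inner_commute power2_norm_eq_inner
        algebra_simps)
  moreover have "l * (2 * M + \<delta>\<^sup>2) * (norm u)\<^sup>2 \<le> \<gamma> * (norm u)\<^sup>2"
    using small by (intro mult_right_mono) auto
  moreover have "\<gamma> * (norm u)\<^sup>2 \<le> w \<bullet> u" using \<phi> by (simp add: w_def)
  ultimately show ?coercive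
    using Au gw unfolding g_def[symmetric] by (simp add: algebra_simps)
  have "norm ?E \<le> norm (g + l *\<^sub>R A) + norm (u + l *\<^sub>R g)"
    unfolding E by (rule norm_Pair_le)
  also have "\<dots> \<le> (norm g + l * norm A) + (norm u + l * norm g)"
    using pos by (intro add_mono norm_triangle_le) auto
  also have "\<dots> \<le> (norm g + l * (M * norm u)) + (norm u + l * norm g)"
    using A pos by simp
  also have "\<dots> \<le> (1 + l + l * M) * (norm u + norm g)"
    using M0 pos by (simp add: algebra_simps)
  finally have nE: "norm ?E \<le> (1 + l + l * M) * (norm u + norm g)" .
  have "norm ?F \<le> norm (- u) + norm (w + g)"
    unfolding F by (rule norm_Pair_le)
  also have "\<dots> \<le> norm u + (\<delta> * norm u + norm g)"
    using \<phi>(2) norm_triangle_ineq[of w g] by (simp add: w_def)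
  also have "\<dots> \<le> (1 + \<delta>) * (norm u + norm g)"
    using pos by (simp add: algebra_simps)
  finally have nF: "norm ?F \<le> (1 + \<delta>) * (norm u + norm g)" .
  have C: "?C > 0" using M0 pos by (simp add: add_pos_nonneg)
  have "norm ?E * norm ?F \<le> ((1 + l + l * M) * (norm u + norm g)) * ((1 + \<delta>) * (norm u + norm g))"
    using nE nF M0 pos by (intro mult_mono) auto
  also have "\<dots> = ?C * (norm u + norm g)\<^sup>2"
    by (simp add: power2_eq_square mult_ac)
  also have "\<dots> \<le> ?C * (2 * ((norm u)\<^sup>2 + (norm g)\<^sup>2))"
    using C sum_squares_bound[of "norm u" "norm g"]
    by (intro mult_left_mono) (auto simp: power2_sum)
  finally have "min \<gamma> l / (4 * ?C) * (norm ?E * norm ?F)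
      \<le> min \<gamma> l / (4 * ?C) * (?C * (2 * ((norm u)\<^sup>2 + (norm g)\<^sup>2)))"
    using C pos by (intro mult_left_mono) auto
  also have "\<dots> = min \<gamma> l / 2 * ((norm u)\<^sup>2 + (norm g)\<^sup>2)"
  proof -
    have "m / (4 * c) * (c * (2 * s)) = m / 2 * s" if "c > 0" for m c s :: real
      using that by (simp add: field_simps)
    from this[OF C] show ?thesis .
  qed
  also have "\<dots> = min \<gamma> l / 2 * (norm u)\<^sup>2 + min \<gamma> l / 2 * (norm g)\<^sup>2"
    by (simp add: distrib_left)
  also have "\<dots> \<le> \<gamma> / 2 * (norm u)\<^sup>2 + l / 2 * (norm g)\<^sup>2"
    by (intro add_mono mult_right_mono) auto
  also have "\<dots> \<le> ?E \<bullet> ?F" using \<open>?coercive\<close> unfolding g_def .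
  finally show ?angle by (simp add: mult.assoc)
qed

section \<open>Solutions of the damped equation\<close>

text \<open>Two-sided derivatives of a solution, away from the initial time, where only one-sided ones are
  given; the time \<open>1\<close> stands for an arbitrary positive one.\<close>

lemma solution_deriv:
  assumes "solution_trajectory f \<phi> x x'" "1 \<le> t"
  shows "(x has_vector_derivative x' t) (at t)"
    and "(x' has_vector_derivative - (grad \<phi> (x' t) + grad f (x t))) (at t)"
proof -
  have at: "at t within {0..} = at t"
    using assms(2) by (intro at_within_interior) auto
  show "(x has_vector_derivative x' t) (at t)"
    using assms unfolding solution_trajectory_def by (metis at order_trans zero_le_one)
  obtain x'' where "(x' has_vector_derivative x'') (at t)" "x'' + grad \<phi> (x' t) + grad f (x t) = 0"
    using assms unfolding solution_trajectory_def by (metis at order_trans zero_le_one)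
  moreover from this have "x'' = - (grad \<phi> (x' t) + grad f (x t))"
    by (metis add.assoc eq_neg_iff_add_eq_0)
  ultimately show "(x' has_vector_derivative - (grad \<phi> (x' t) + grad f (x t))) (at t)"
    by simp
qed

lemma solution_continuous:
  assumes "solution_trajectory f \<phi> x x'"
  shows "continuous_on {0..} x" "continuous_on {0..} x'"
  using assms unfolding solution_trajectory_def continuous_on_eq_continuous_within
  by (meson atLeast_iff has_vector_derivative_continuous)+

lemma lipschitz_on_of_bounded_speed:
  fixes y :: "real \<Rightarrow> 'a::real_normed_vector"
  assumes "\<And>t. T \<le> t \<Longrightarrow> (y has_vector_derivative v t) (at t)"
    and "\<And>t. T \<le> t \<Longrightarrow> norm (v t) \<le> K"
  shows "K-lipschitz_on {T..} y"
proof (rule lipschitz_onI)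
  show "0 \<le> K" using assms(2)[of T] norm_ge_zero order_trans by blast
  fix s t assume "s \<in> {T..}" "t \<in> {T..}"
  then have "norm (y s - y t) \<le> K * norm (s - t)"
    using assms
    by (intro differentiable_bound[of "{T..}" y "\<lambda>t h. h *\<^sub>R v t"])
      (auto simp: has_vector_derivative_def onorm_scaleR_left bounded_linear_ident onorm_id
        intro: has_derivative_at_withinI)
  then show "dist (y s) (y t) \<le> K * dist s t" by (simp add: dist_norm)
qed

text \<open>The mechanical energy is nonincreasing and \<open>f\<close> is bounded below, so the velocity is bounded; by
  the equation the acceleration is bounded too, and \<open>tendsto_zero_of_dissipation\<close> applies to the
  velocity itself.\<close>

lemma solution_velocity:
  fixes f \<phi> :: "'a::euclidean_space \<Rightarrow> real"
  assumes f_diff: "\<And>w. f differentiable (at w)"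
    and grad_f_cont: "continuous_on UNIV (grad f)"
    and f_bdd: "bdd_below (range f)"
    and conv: "convex_on UNIV \<phi>" and \<phi>0: "\<phi> 0 = 0"
    and \<phi>_diff: "\<And>u. \<phi> differentiable (at u)"
    and grad_\<phi>_cont: "continuous_on UNIV (grad \<phi>)"
    and c: "p \<ge> 1" "c > 0" and growth: "\<And>u. \<phi> u \<ge> c * norm u powr p"
    and sol: "solution_trajectory f \<phi> x x'"
    and x_bdd: "bounded (x ` {0..})"
  shows "\<exists>K. K-lipschitz_on {1..} x" and "(x' \<longlongrightarrow> 0) at_top"
proof -
  obtain m where m: "\<And>w. m \<le> f w" using f_bdd by (auto simp: bdd_below_def)
  define h where "h = (\<lambda>t. (x' t \<bullet> x' t) / 2 + f (x t))"
  have h: "(h has_real_derivative - (grad \<phi> (x' t) \<bullet> x' t)) (at t)" if "1 \<le> t" for t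
  proof -
    note d = solution_deriv[OF sol that]
    have kin: "((\<lambda>t. x' t \<bullet> x' t) has_real_derivative
        2 * (x' t \<bullet> (- (grad \<phi> (x' t) + grad f (x t))))) (at t)"
      using bounded_bilinear.has_vector_derivative[OF bounded_bilinear_inner d(2) d(2)]
      by (simp add: has_real_derivative_iff_has_vector_derivative inner_commute)
    have pot: "((\<lambda>t. f (x t)) has_real_derivative grad f (x t) \<bullet> x' t) (at t)"
      by (intro has_real_derivative_along_curve f_diff d)
    have "2 * (x' t \<bullet> (- (grad \<phi> (x' t) + grad f (x t)))) / 2 + grad f (x t) \<bullet> x' t
        = - (grad \<phi> (x' t) \<bullet> x' t)"
      by (simp add: inner_diff_right inner_commute field_simps)
    then show ?thesis
      unfolding h_def using DERIV_add[OF DERIV_cdivide[OF kin, of 2] pot] by simp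
  qed
  have dissip: "- (grad \<phi> (x' t) \<bullet> x' t) \<le> - (c * norm (x' t) powr p)" for t
    using convex_le_inner_grad[OF conv \<phi>_diff \<phi>0, of "x' t"] growth[of "x' t"] by simp
  have nonpos: "- (grad \<phi> (x' t) \<bullet> x' t) \<le> 0" for t
    using dissip[of t] c by (smt (verit) mult_nonneg_nonneg powr_ge_zero)
  have "norm (x' t) \<le> sqrt (2 * (h 1 - m))" if "1 \<le> t" for t
  proof (rule real_le_rsqrt)
    have "h t \<le> h 1"
      using nonincreasing_of_deriv_nonpos[OF h nonpos _ that] by simp
    then show "(norm (x' t))\<^sup>2 \<le> 2 * (h 1 - m)"
      using m[of "x t"] by (simp add: h_def power2_norm_eq_inner)
  qed
  then obtain B where B: "\<And>t. 1 \<le> t \<Longrightarrow> norm (x' t) \<le> B" by blast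
  have "bounded (grad \<phi> ` cball 0 B)"
    by (intro compact_imp_bounded compact_continuous_image continuous_on_subset[OF grad_\<phi>_cont]) auto
  then obtain B1 where B1: "\<And>u. norm u \<le> B \<Longrightarrow> norm (grad \<phi> u) \<le> B1"
    unfolding bounded_iff by (metis image_eqI mem_cball_0)
  have "bounded (grad f ` closure (x ` {0..}))"
    using x_bdd by (intro compact_imp_bounded compact_continuous_image
        continuous_on_subset[OF grad_f_cont]) (auto simp: compact_closure)
  then obtain B2 where B2: "\<And>t. 0 \<le> t \<Longrightarrow> norm (grad f (x t)) \<le> B2"
    unfolding bounded_iff by (metis atLeast_iff closure_subset image_eqI subsetD)
  show "\<exists>K. K-lipschitz_on {1..} x"
    using lipschitz_on_of_bounded_speed[of 1 x x' B] solution_deriv[OF sol] B by blast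
  have "(B1 + B2)-lipschitz_on {1..} x'"
  proof (rule lipschitz_on_of_bounded_speed)
    fix t :: real assume t: "1 \<le> t"
    show "(x' has_vector_derivative - (grad \<phi> (x' t) + grad f (x t))) (at t)"
      by (rule solution_deriv[OF sol t])
    show "norm (- (grad \<phi> (x' t) + grad f (x t))) \<le> B1 + B2"
      using B1[OF B[OF t]] B2[of t] t by (simp only: norm_minus_cancel) (intro norm_triangle_mono, auto)
  qed
  moreover have "m \<le> h t" for t
    using m[of "x t"] by (simp add: h_def add_increasing)
  ultimately show "(x' \<longlongrightarrow> 0) at_top"
    using c by (intro tendsto_zero_of_dissipation[OF h dissip, of 1 m "B1 + B2"])
      (auto intro!: mult_left_mono powr_mono2)
qed

section \<open>Integrability on a half-line\<close>

lemma absolutely_integrable_on_half_line: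
  fixes v :: "real \<Rightarrow> 'a::euclidean_space"
  assumes cont: "continuous_on {0..} v" and a: "0 \<le> a"
    and B: "\<And>b. a \<le> b \<Longrightarrow> integral {a..b} (\<lambda>t. norm (v t)) \<le> B"
  shows "v absolutely_integrable_on {0<..}"
proof -
  let ?n = "\<lambda>t. norm (v t)"
  have int: "?n integrable_on {s..t}" if "0 \<le> s" for s t
    using that by (intro integrable_continuous_interval continuous_on_norm
        continuous_on_subset[OF cont]) auto
  let ?g = "\<lambda>k t. if t \<in> {0..real k} then ?n t else 0"
  have inter: "{0..real k} \<inter> {0..} = {0..real k}" for k by auto
  have val: "integral {0..} (?g k) = integral {0..real k} ?n" for k
    using integral_restrict_Int[of "{0..}" "{0..real k}" ?n] inter by simp
  have "?n integrable_on {0..} \<and>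
      (\<lambda>k. integral {0..} (?g k)) \<longlonglongrightarrow> integral {0..} ?n"
  proof (rule monotone_convergence_increasing)
    show "?g k integrable_on {0..}" for k
      using integrable_restrict_Int[of "{0..real k}" ?n "{0..}"] inter int by simp
    show "?g k t \<le> ?g (Suc k) t" for k t by auto
    show "(\<lambda>k. ?g k t) \<longlonglongrightarrow> ?n t" if "t \<in> {0..}" for t
    proof (rule tendsto_eventually)
      show "\<forall>\<^sub>F k in sequentially. ?g k t = ?n t"
        using eventually_ge_at_top[of "nat \<lceil>t\<rceil>"]
        by eventually_elim (use that in \<open>auto simp: nat_le_iff ceiling_le_iff\<close>)
    qed
    show "bounded (range (\<lambda>k. integral {0..} (?g k)))"
      unfolding bounded_iff val
    proof (intro exI ballI, clarify)
      fix k
      let ?b = "max a (real k)"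
      have "integral {0..real k} ?n \<le> integral {0..?b} ?n"
        by (intro integral_subset_le int) auto
      also have "\<dots> = integral {0..a} ?n + integral {a..?b} ?n"
        using a by (intro Henstock_Kurzweil_Integration.integral_combine[symmetric] int) auto
      also have "\<dots> \<le> integral {0..a} ?n + B" using B by simp
      finally have "integral {0..real k} ?n \<le> integral {0..a} ?n + B" .
      moreover have "0 \<le> integral {0..real k} ?n"
        by (intro Henstock_Kurzweil_Integration.integral_nonneg int) auto
      ultimately show "norm (integral {0..real k} ?n) \<le> integral {0..a} ?n + B" by simp
    qed
  qed
  then have "v absolutely_integrable_on {0..}"
    by (intro measurable_bounded_by_integrable_imp_absolutely_integrable[where g = ?n]
        continuous_imp_measurable_on_sets_lebesgue cont) auto
  then show ?thesis
    by (rule set_integrable_subset) auto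
qed

section \<open>Convergence of bounded trajectories\<close>

theorem theorem7p3:
  fixes f \<phi> :: "real ^ 'n \<Rightarrow> real"
    and x x' :: "real \<Rightarrow> real ^ 'n"
    and \<gamma> \<delta> \<epsilon> p c R :: real
  assumes f_C2: "C2_function f"
    and grad_f_lipschitz: "\<And>B. bounded B \<Longrightarrow> \<exists>L. L-lipschitz_on B (grad f)"
    and f_bdd_below: "bdd_below (range f)"
    and KL: "\<exists>l0>0. \<forall>l. 0 < l \<and> l < l0 \<longrightarrow> KL_property (E_fun f l)"
    and damping: "damping_potential \<phi>"
    and \<phi>_differentiable: "\<And>u. \<phi> differentiable (at u)"
    and grad_\<phi>_lipschitz: "\<And>u. \<exists>r>0. \<exists>L. L-lipschitz_on (cball u r) (grad \<phi>)"
    and local_pos: "\<gamma> > 0" "\<delta> > 0" "\<epsilon> > 0"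
    and local_growth:
      "\<And>u. norm u \<le> \<epsilon> \<Longrightarrow> \<phi> u \<ge> \<gamma> * (norm u)\<^sup>2 \<and> norm (grad \<phi> u) \<le> \<delta> * norm u"
    and global_pos: "p \<ge> 1" "c > 0"
    and global_growth: "\<And>u. \<phi> u \<ge> c * norm u powr p"
    and solution: "solution_trajectory f \<phi> x x'"
    and x_bounded: "bounded (x ` {0..})"
    and R: "R \<ge> (SUP t\<in>{0..}. norm (x t))"
  shows "\<exists>xinf.
    ((x \<longlongrightarrow> xinf) at_top \<and> grad f xinf = 0) \<and>
    (x' absolutely_integrable_on {0<..} \<and> (x' \<longlongrightarrow> 0) at_top) \<and>
    (\<exists>l1>0. \<forall>l. 0 < l \<and> l < l1 \<longrightarrow>
      (\<exists>\<alpha>>0.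
        (\<forall>z \<in> cball 0 R \<times> cball 0 \<epsilon>.
          grad (E_fun f l) z \<bullet> F_field f \<phi> z
            \<ge> \<alpha> * norm (grad (E_fun f l) z) * norm (F_field f \<phi> z)) \<and>
        (\<forall>\<eta> \<theta>. desingularizing (E_fun f l) (xinf, 0) \<eta> \<theta> \<longrightarrow>
          (\<forall>\<^sub>F t in at_top.
            E_fun f l (x t, x' t) - E_fun f l (xinf, 0) \<in> {0..<\<eta>} \<and>
            norm (x t - xinf)
              \<le> 1 / \<alpha> * \<theta> (E_fun f l (x t, x' t) - E_fun f l (xinf, 0))))))"
proof -
  obtain H :: "real ^ 'n \<Rightarrow> (real ^ 'n) \<Rightarrow>\<^sub>L (real ^ 'n)"
    where f_diff: "\<And>w. f differentiable (at w)"
      and H: "\<And>w. (grad f has_derivative blinfun_apply (H w)) (at w)"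
      and H_cont: "continuous_on UNIV H"
    using f_C2 unfolding C2_function_def by blast
  have grad_f_cont: "continuous_on UNIV (grad f)"
    by (intro continuous_at_imp_continuous_on ballI has_derivative_continuous[OF H])
  have grad_\<phi>_cont: "continuous_on UNIV (grad \<phi>)"
  proof (intro continuous_at_imp_continuous_on ballI)
    fix u
    obtain r L where "r > 0" "L-lipschitz_on (cball u r) (grad \<phi>)"
      using grad_\<phi>_lipschitz[of u] by auto
    then show "isCont (grad \<phi>) u"
      by (intro continuous_on_interior[of "cball u r"])
        (auto intro: lipschitz_on_continuous_on)
  qed
  have conv: "convex_on UNIV \<phi>" and \<phi>0: "\<phi> 0 = 0"
    using damping by (auto simp: damping_potential_def)
  have \<phi>_coercive: "\<gamma> * (norm u)\<^sup>2 \<le> grad \<phi> u \<bullet> u" if "norm u \<le> \<epsilon>" for u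
    using local_growth[OF that] convex_le_inner_grad[OF conv \<phi>_differentiable \<phi>0, of u] by simp
  have x_le_R: "norm (x t) \<le> R" if "0 \<le> t" for t
  proof -
    have "bdd_above ((\<lambda>t. norm (x t)) ` {0..})"
      using x_bounded by (force simp: bounded_iff bdd_above_def)
    then have "norm (x t) \<le> (SUP t\<in>{0..}. norm (x t))"
      using that by (intro cSUP_upper) auto
    with R show ?thesis by simp
  qed
  have "bounded (H ` cball 0 R)"
    by (intro compact_imp_bounded compact_continuous_image continuous_on_subset[OF H_cont]) auto
  then obtain M where M: "\<And>w. norm w \<le> R \<Longrightarrow> norm (H w) \<le> M"
    unfolding bounded_iff by (metis image_eqI mem_cball_0)
  have M0: "M \<ge> 0"
    using M[of "x 0"] x_le_R[of 0] norm_ge_zero order_trans by blast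

  define l1 where "l1 = \<gamma> / (2 * M + \<delta>\<^sup>2 + 1)"
  have den: "2 * M + \<delta>\<^sup>2 + 1 > 0" using M0 by (simp add: add_nonneg_pos)
  have l1: "l1 > 0" using den local_pos by (simp add: l1_def)
  have small: "l * (2 * M + \<delta>\<^sup>2) \<le> \<gamma>" if "0 < l" "l < l1" for l
  proof -
    have "l * (2 * M + \<delta>\<^sup>2 + 1) < \<gamma>"
      using that(2) den by (simp add: l1_def pos_less_divide_eq)
    then show ?thesis using that by (simp add: algebra_simps)
  qed
  define \<alpha> where "\<alpha> = (\<lambda>l. min \<gamma> l / (4 * ((1 + l + l * M) * (1 + \<delta>))))"
  have \<alpha>_pos: "\<alpha> l > 0" if "0 < l" for l
    using that M0 local_pos by (auto simp: \<alpha>_def intro!: divide_pos_pos mult_pos_pos add_pos_nonneg)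
  note angle = E_fun_angle[OF f_diff H M \<phi>_coercive conjunct2[OF local_growth] local_pos(1,2)]

  have vel: "\<exists>K. K-lipschitz_on {1..} x" "(x' \<longlongrightarrow> 0) at_top"
    using solution_velocity[OF f_diff grad_f_cont f_bdd_below conv \<phi>0 \<phi>_differentiable
        grad_\<phi>_cont global_pos global_growth solution x_bounded] by blast+
  have "\<forall>\<^sub>F t in at_top. norm (x' t) < \<epsilon>"
    using order_tendstoD(2)[OF tendsto_norm_zero[OF vel(2)] local_pos(3)] .
  then obtain T0 where T0: "\<And>t. T0 \<le> t \<Longrightarrow> norm (x' t) < \<epsilon>"
    unfolding eventually_at_top_linorder by blast
  define T where "T = max 1 T0"
  have T: "1 \<le> T" and vel_small: "\<And>t. T \<le> t \<Longrightarrow> norm (x' t) \<le> \<epsilon>"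
    using T0 by (auto simp: T_def less_imp_le)

  define z where "z = (\<lambda>t. (x t, x' t))"
  define V where "V = (\<lambda>t. (x' t, - (grad \<phi> (x' t) + grad f (x t))))"
  have V: "V t = - F_field f \<phi> (z t)" for t
    by (simp add: V_def z_def F_field_def)
  have E_deriv: "(E_fun f l has_derivative (\<lambda>h. h \<bullet> grad (E_fun f l) w)) (at w)" for l w
    using E_fun_has_derivative[OF f_diff H, of l "fst w" "snd w"] grad_eqI by fastforce
  have coercive: "grad (E_fun f l) (z t) \<bullet> V t
      \<le> - (\<gamma> / 2 * (norm (x' t))\<^sup>2 + l / 2 * (norm (grad f (x t)))\<^sup>2)"
    if "0 < l" "l < l1" "T \<le> t" for l t
    using angle(1)[of "x t" "x' t" l] that T small vel_small x_le_R by (simp add: V z_def)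
  have descent: "angle_descent (E_fun f l) z V (\<alpha> l) T" if l: "0 < l" "l < l1" for l
  proof
    show "\<alpha> l > 0" using \<alpha>_pos l by blast
    show "E_fun f l differentiable (at w)" for w
      using E_deriv unfolding differentiable_def by blast
    show "(z has_vector_derivative V t) (at t)" if "T \<le> t" for t
      unfolding z_def V_def using that T
      by (intro has_vector_derivative_Pair solution_deriv[OF solution]) auto
    have "continuous_on {T..} x" "continuous_on {T..} x'"
      using solution_continuous[OF solution] T by (auto intro: continuous_on_subset)
    then show "continuous_on {T..} V"
      unfolding V_def
      by (intro continuous_intros continuous_on_compose2[OF grad_\<phi>_cont]
          continuous_on_compose2[OF grad_f_cont]) auto
    fix t assume t: "T \<le> t"
    show "\<alpha> l * norm (grad (E_fun f l) (z t)) * norm (V t) \<le> - (grad (E_fun f l) (z t) \<bullet> V t)"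
      using angle(2)[of "x t" "x' t" l] l t T small vel_small x_le_R
      by (simp add: V z_def \<alpha>_def)
    assume "grad (E_fun f l) (z t) \<bullet> V t = 0"
    then have "\<gamma> / 2 * (norm (x' t))\<^sup>2 + l / 2 * (norm (grad f (x t)))\<^sup>2 \<le> 0"
      using coercive[OF l t] by simp
    then have "\<gamma> / 2 * (norm (x' t))\<^sup>2 = 0 \<and> l / 2 * (norm (grad f (x t)))\<^sup>2 = 0"
      using local_pos l by (subst add_nonneg_eq_0_iff[symmetric]) (auto intro: antisym add_nonneg_nonneg)
    then have "x' t = 0" "grad f (x t) = 0" using local_pos l by auto
    moreover have "grad \<phi> 0 = 0"
      using local_growth[of 0] local_pos by auto
    ultimately show "V t = 0" by (simp add: V_def zero_prod_def)
  qed

  obtain l0 where l0: "l0 > 0" "\<And>l. 0 < l \<Longrightarrow> l < l0 \<Longrightarrow> KL_property (E_fun f l)"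
    using KL by blast
  \<comment> \<open>One admissible parameter is enough to find the limit of the trajectory; the rate is then proved for
      every parameter below \<open>l1\<close>.\<close>
  define l where "l = min l0 l1 / 2"
  have l: "0 < l" "l < l0" "l < l1" using l0 l1 by (auto simp: l_def)
  interpret E: angle_descent "E_fun f l" z V "\<alpha> l" T
    using descent l by blast

  \<comment> \<open>The energy dissipates at least \<open>l/2 \<bar>\<nabla>f(x)\<bar>\<^sup>2\<close>, which makes every cluster point critical.\<close>
  have grad_to_0: "((\<lambda>t. grad f (x t)) \<longlongrightarrow> 0) at_top"
  proof -
    obtain K where K: "K-lipschitz_on {T..} x"
      using vel(1) T by (meson atLeast_subset_iff lipschitz_on_subset)
    have "bounded (x ` {T..})"
      using x_bounded T by (auto intro: bounded_subset)
    then obtain L where "L-lipschitz_on (x ` {T..}) (grad f)"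
      using grad_f_lipschitz by blast
    then have lip: "(L * K)-lipschitz_on {T..} (\<lambda>t. grad f (x t))"
      using lipschitz_on_compose2[OF K] by blast
    have "bounded (E_fun f l ` (cball 0 R \<times> cball 0 \<epsilon>))"
      using E.G_diff by (intro compact_imp_bounded compact_continuous_image compact_Times
          compact_cball continuous_at_imp_continuous_on ballI differentiable_imp_continuous_within)
    then obtain m where "\<forall>w \<in> cball 0 R \<times> cball 0 \<epsilon>. \<bar>E_fun f l w\<bar> \<le> m"
      unfolding bounded_iff by (auto simp only: ball_simps real_norm_def)
    moreover have "z t \<in> cball 0 R \<times> cball 0 \<epsilon>" if "T \<le> t" for t
      using x_le_R[of t] vel_small[OF that] that T by (simp add: z_def)
    ultimately have m: "\<bar>E_fun f l (z t)\<bar> \<le> m" if "T \<le> t" for t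
      using that by blast
    show ?thesis
    proof (rule tendsto_zero_of_dissipation[OF E.value_deriv])
      show "grad (E_fun f l) (z t) \<bullet> V t \<le> - (l / 2 * (norm (grad f (x t)))\<^sup>2)" if "T \<le> t" for t
        using coercive[OF l(1,3) that] local_pos by (smt (verit) mult_nonneg_nonneg zero_le_power2 half_gt_zero)
      show "- m \<le> E_fun f l (z t)" if "T \<le> t" for t using m[OF that] by simp
    qed (use l lip in \<open>auto intro!: mult_left_mono power_mono\<close>)
  qed

  have "\<forall>k. x (T + real k) \<in> cball 0 R" using x_le_R T by simp
  then obtain xinf r where r: "strict_mono r" and "((\<lambda>k. x (T + real k)) \<circ> r) \<longlonglongrightarrow> xinf"
    using compact_cball[of "0 :: real ^ 'n" R] unfolding compact_def by metis
  then have x_sub: "(\<lambda>k. x (T + real (r k))) \<longlonglongrightarrow> xinf" by (simp add: o_def)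
  have times: "filterlim (\<lambda>k. T + real (r k)) at_top sequentially"
    using filterlim_compose[OF filterlim_real_sequentially filterlim_subseq[OF r]]
    by (intro filterlim_tendsto_add_at_top[OF tendsto_const])
  have crit: "grad f xinf = 0"
  proof -
    have "isCont (grad f) xinf"
      using grad_f_cont by (simp add: continuous_on_eq_continuous_at)
    then have "(\<lambda>k. grad f (x (T + real (r k)))) \<longlonglongrightarrow> grad f xinf"
      using x_sub isCont_tendsto_compose by blast
    then show ?thesis
      using filterlim_compose[OF grad_to_0 times] LIMSEQ_unique by blast
  qed
  have cluster: "\<forall>\<rho>>0. \<forall>S. \<exists>t\<ge>S. dist (z t) (xinf, 0) < \<rho>"
  proof (intro allI impI)
    fix \<rho> S :: real assume "\<rho> > 0"
    have "(\<lambda>k. z (T + real (r k))) \<longlonglongrightarrow> (xinf, 0)"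
      unfolding z_def by (intro tendsto_Pair x_sub filterlim_compose[OF vel(2) times])
    then have "\<forall>\<^sub>F k in sequentially. dist (z (T + real (r k))) (xinf, 0) < \<rho>"
      using \<open>\<rho> > 0\<close> by (rule tendstoD)
    moreover have "\<forall>\<^sub>F k in sequentially. S \<le> T + real (r k)"
      using times by (auto simp: filterlim_at_top)
    ultimately have "\<forall>\<^sub>F k in sequentially.
        S \<le> T + real (r k) \<and> dist (z (T + real (r k))) (xinf, 0) < \<rho>"
      by eventually_elim auto
    then show "\<exists>t\<ge>S. dist (z t) (xinf, 0) < \<rho>"
      using eventually_happens' sequentially_bot by blast
  qed
  have "grad (E_fun f l) (xinf, 0) = 0"
    using grad_eqI[OF E_fun_has_derivative[OF f_diff H, of l xinf 0]] crit
      adjoint_linear[of "blinfun_apply (H xinf)"]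
    by (simp add: zero_prod_def linear_0 blinfun.bounded_linear_right bounded_linear.linear)
  then obtain \<eta> \<theta> where des: "desingularizing (E_fun f l) (xinf, 0) \<eta> \<theta>"
    using l0(2)[OF l(1,2)] unfolding KL_property_def by blast
  have x_lim: "(x \<longlongrightarrow> xinf) at_top"
    using tendsto_fst[OF E.converges_with_finite_length(1)[OF des cluster]] by (simp add: z_def)
  have x'_int: "x' absolutely_integrable_on {0<..}"
  proof -
    have "\<forall>\<^sub>F a in at_top. T \<le> a \<and> (\<exists>B. \<forall>b\<ge>a. integral {a..b} (\<lambda>t. norm (V t)) \<le> B)"
      using E.converges_with_finite_length(2)[OF des cluster] eventually_ge_at_top[of T]
      by eventually_elim blast
    then obtain a B where a: "T \<le> a" and B: "\<And>b. a \<le> b \<Longrightarrow> integral {a..b} (\<lambda>t. norm (V t)) \<le> B"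
      using eventually_happens'[OF trivial_limit_at_top_linorder] by blast
    show ?thesis
    proof (rule absolutely_integrable_on_half_line[OF solution_continuous(2)[OF solution]])
      show "0 \<le> a" using a T by simp
      fix b assume b: "a \<le> b"
      have "integral {a..b} (\<lambda>t. norm (x' t)) \<le> integral {a..b} (\<lambda>t. norm (V t))"
      proof (rule integral_le)
        show "(\<lambda>t. norm (x' t)) integrable_on {a..b}"
          using a T by (intro integrable_continuous_interval continuous_on_norm
              continuous_on_subset[OF solution_continuous(2)[OF solution]]) auto
        show "norm (x' t) \<le> norm (V t)" for t
          unfolding V_def by (rule norm_fst_le)
      qed (rule E.speed_integrable[OF a])
      also have "\<dots> \<le> B" by (rule B[OF b])
      finally show "integral {a..b} (\<lambda>t. norm (x' t)) \<le> B" .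
    qed
  qed

  have angle_on_\<Gamma>: "grad (E_fun f l) w \<bullet> F_field f \<phi> w
      \<ge> \<alpha> l * norm (grad (E_fun f l) w) * norm (F_field f \<phi> w)"
    if "0 < l" "l < l1" "w \<in> cball 0 R \<times> cball 0 \<epsilon>" for l w
    using that angle(2)[of "fst w" "snd w" l] small unfolding \<alpha>_def by (cases w) auto
  have rate: "\<forall>\<^sub>F t in at_top.
      E_fun f l (x t, x' t) - E_fun f l (xinf, 0) \<in> {0..<\<eta>} \<and>
      norm (x t - xinf) \<le> 1 / \<alpha> l * \<theta> (E_fun f l (x t, x' t) - E_fun f l (xinf, 0))"
    if l: "0 < l" "l < l1" and des: "desingularizing (E_fun f l) (xinf, 0) \<eta> \<theta>" for l \<eta> \<theta>
    using angle_descent.converges_with_finite_length(2)[OF descent[OF l] des cluster]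
  proof eventually_elim
    case (elim t)
    moreover have "norm (x t - xinf) \<le> norm (z t - (xinf, 0))"
      using norm_fst_le[of "x t - xinf" "x' t"] by (simp add: z_def)
    ultimately show ?case unfolding z_def by (blast intro: order_trans)
  qed
  show ?thesis
    using x_lim crit x'_int vel(2) l1 \<alpha>_pos angle_on_\<Gamma> rate by blast
qed

end
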